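(* If $X$ is a quasi-Polish space, then $\mathbf{A}(\mathbf{O}(X))$ with the lower Vietoris topology is homeomorphic to $\mathbf{O}(\mathbf{K}(X))$ with the Scott topology, via the map $\alpha\colon\mathbf{A}(\mathbf{O}(X))\to\mathbf{O}(\mathbf{K}(X))$ and its inverse $\beta\colon\mathbf{O}(\mathbf{K}(X))\to\mathbf{A}(\mathbf{O}(X))$.
   Context: A subset $A$ of a topological space $Y$ is a $\mathbf{\Pi}^0_2$-subset if there are sequences $(U_i)_{i\in\omega}$ and $(V_i)_{i\in\omega}$ of open subsets of $Y$ such that $x\in A$ if and only if for all $i\in\omega$, $x\in U_i$ implies $x\in V_i$. A topological space is quasi-Polish if it is countably based and its topology is induced by a Smyth-complete quasi-metric; equivalently, if it is homeomorphic to a $\mathbf{\Pi}^0_2$-subset of an $\omega$-algebraic domain with the Scott topology (one may always take the domain to be $\mathcal{P}(\omega)$, the powerset of $\omega$ ordered by inclusion, with the Scott topology). For a topological space $Y$: $\mathbf{A}(Y)$ is the set of all closed subsets of $Y$ with the lower Vietoris topology, generated by the sets $\Diamond U=\{A\in\mathbf{A}(Y)\mid A\cap U\neq\emptyset\}$ for $U\subseteq Y$ open. $\mathbf{K}(Y)$ is the set of all compact saturated subsets of $Y$ with the upper Vietoris topology, generated by the sets $\Box U=\{K\in\mathbf{K}(Y)\mid K\subseteq U\}$ for $U\subseteq Y$ open. (Compact: every open cover has a finite subcover. Saturated: equal to the intersection of all its open neighborhoods.) $\mathbf{O}(Y)$ is the lattice of open subsets of $Y$ ordered by inclusion and equipped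 with the Scott topology. The maps are $$\alpha(\mathfrak{A})=\bigcup_{U\in\mathfrak{A}}\Box U,\qquad \beta(\mathcal{U})=\{U\in\mathbf{O}(X)\mid\Box U\subseteq\mathcal{U}\}$$ for $\mathfrak{A}\in\mathbf{A}(\mathbf{O}(X))$ and $\mathcal{U}\in\mathbf{O}(\mathbf{K}(X))$. *)

theory Defs
  imports "HOL-Analysis.Analysis" "HOL-Library.Lub_Glb"
begin

subsection \<open>Quasi-Polish spaces\<close>

text \<open>Quasi-metrics are real-valued and separate points in the \<open>T\<^sub>0\<close> sense. The open ball around
  \<open>x\<close> consists of the \<open>y\<close> with \<open>d x y < \<epsilon>\<close>; the order of the arguments of \<open>d\<close> there and in the
  Cauchy condition matters.\<close>

definition quasi_metric_on :: "'a set \<Rightarrow> ('a \<Rightarrow> 'a \<Rightarrow> real) \<Rightarrow> bool" where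
  "quasi_metric_on M d \<longleftrightarrow>
     (\<forall>x\<in>M. \<forall>y\<in>M. 0 \<le> d x y) \<and>
     (\<forall>x\<in>M. \<forall>y\<in>M. x = y \<longleftrightarrow> d x y = 0 \<and> d y x = 0) \<and>
     (\<forall>x\<in>M. \<forall>y\<in>M. \<forall>z\<in>M. d x z \<le> d x y + d y z)"

definition quasi_metric_induces :: "('a \<Rightarrow> 'a \<Rightarrow> real) \<Rightarrow> 'a topology \<Rightarrow> bool" where
  "quasi_metric_induces d X \<longleftrightarrow>
     (\<forall>U. openin X U \<longleftrightarrow>
        U \<subseteq> topspace X \<and> (\<forall>x\<in>U. \<exists>\<epsilon>>0. {y \<in> topspace X. d x y < \<epsilon>} \<subseteq> U))"

definition quasi_Cauchy :: "('a \<Rightarrow> 'a \<Rightarrow> real) \<Rightarrow> (nat \<Rightarrow> 'a) \<Rightarrow> bool" where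
  "quasi_Cauchy d \<sigma> \<longleftrightarrow> (\<forall>\<epsilon>>0. \<exists>N. \<forall>n\<ge>N. \<forall>m\<ge>n. d (\<sigma> n) (\<sigma> m) < \<epsilon>)"

text \<open>Cauchy sequences are required to converge with respect to the symmetrised metric
  \<open>max (d x y) (d y x)\<close>, not just in the topology induced by \<open>d\<close>.\<close>

definition Smyth_complete_on :: "'a set \<Rightarrow> ('a \<Rightarrow> 'a \<Rightarrow> real) \<Rightarrow> bool" where
  "Smyth_complete_on M d \<longleftrightarrow>
     (\<forall>\<sigma>. range \<sigma> \<subseteq> M \<and> quasi_Cauchy d \<sigma> \<longrightarrow>
        (\<exists>x\<in>M. (\<lambda>n. max (d x (\<sigma> n)) (d (\<sigma> n) x)) \<longlonglongrightarrow> 0))"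

definition quasi_Polish_space :: "'a topology \<Rightarrow> bool" where
  "quasi_Polish_space X \<longleftrightarrow>
     second_countable X \<and>
     (\<exists>d. quasi_metric_on (topspace X) d \<and> Smyth_complete_on (topspace X) d \<and>
          quasi_metric_induces d X)"

subsection \<open>The Scott topology\<close>

definition directed_set :: "'a::order set \<Rightarrow> bool" where
  "directed_set D \<longleftrightarrow> D \<noteq> {} \<and> (\<forall>x\<in>D. \<forall>y\<in>D. \<exists>z\<in>D. x \<le> z \<and> y \<le> z)"

text \<open>\<open>L\<close> carries the order restricted from the type, and suprema are taken within \<open>L\<close>.\<close>

definition Scott_open :: "'a::order set \<Rightarrow> 'a set \<Rightarrow> bool" where
  "Scott_open L W \<longleftrightarrow>
     W \<subseteq> L \<and>
     (\<forall>x\<in>W. \<forall>y\<in>L. x \<le> y \<longrightarrow> y \<in> W) \<and>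
     (\<forall>D s. D \<subseteq> L \<and> directed_set D \<and> isLub L D s \<and> s \<in> W \<longrightarrow> D \<inter> W \<noteq> {})"

definition Scott_topology :: "'a::order set \<Rightarrow> 'a topology" where
  "Scott_topology L = topology (Scott_open L)"

lemma Scott_open_subset: "Scott_open L W \<Longrightarrow> W \<subseteq> L"
  by (simp add: Scott_open_def)

lemma Scott_open_upward: "\<lbrakk>Scott_open L W; x \<in> W; y \<in> L; x \<le> y\<rbrakk> \<Longrightarrow> y \<in> W"
  by (simp add: Scott_open_def)

lemma Scott_open_directed:
  "\<lbrakk>Scott_open L W; D \<subseteq> L; directed_set D; isLub L D s; s \<in> W\<rbrakk> \<Longrightarrow> \<exists>x. x \<in> D \<and> x \<in> W"
  unfolding Scott_open_def by (metis disjoint_iff)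

lemma Scott_openI:
  assumes "W \<subseteq> L"
    and "\<And>x y. \<lbrakk>x \<in> W; y \<in> L; x \<le> y\<rbrakk> \<Longrightarrow> y \<in> W"
    and "\<And>D s. \<lbrakk>D \<subseteq> L; directed_set D; isLub L D s; s \<in> W\<rbrakk> \<Longrightarrow> \<exists>x. x \<in> D \<and> x \<in> W"
  shows "Scott_open L W"
  unfolding Scott_open_def disjoint_iff using assms by metis

lemma istopology_Scott_open: "istopology (Scott_open L)"
  unfolding istopology_def
proof (intro conjI allI impI)
  fix S T assume S: "Scott_open L S" and T: "Scott_open L T"
  show "Scott_open L (S \<inter> T)"
  proof (rule Scott_openI)
    show "S \<inter> T \<subseteq> L" using Scott_open_subset[OF S] by auto
  next
    fix x y assume "x \<in> S \<inter> T" "y \<in> L" "x \<le> y"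
    then show "y \<in> S \<inter> T" using Scott_open_upward[OF S] Scott_open_upward[OF T] by (metis Int_iff)
  next
    fix D s assume D: "D \<subseteq> L" "directed_set D" "isLub L D s" and s: "s \<in> S \<inter> T"
    obtain x where x: "x \<in> D" "x \<in> S" using Scott_open_directed[OF S D] s by auto
    obtain y where y: "y \<in> D" "y \<in> T" using Scott_open_directed[OF T D] s by auto
    obtain z where z: "z \<in> D" "x \<le> z" "y \<le> z"
      using D(2) x(1) y(1) unfolding directed_set_def by meson
    have "z \<in> L" using z(1) D(1) by (rule subsetD[rotated])
    then have "z \<in> S" "z \<in> T"
      using Scott_open_upward[OF S x(2)] Scott_open_upward[OF T y(2)] z by simp_all
    then show "\<exists>x. x \<in> D \<and> x \<in> S \<inter> T" using z(1) by auto
  qed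
next
  fix \<K> assume *: "\<forall>K\<in>\<K>. Scott_open L K"
  show "Scott_open L (\<Union>\<K>)"
  proof (rule Scott_openI)
    show "\<Union>\<K> \<subseteq> L" using * Scott_open_subset by (metis Sup_least)
  next
    fix x y assume "x \<in> \<Union>\<K>" "y \<in> L" "x \<le> y"
    then show "y \<in> \<Union>\<K>" using * Scott_open_upward by (metis UnionE UnionI)
  next
    fix D s assume D: "D \<subseteq> L" "directed_set D" "isLub L D s" and s: "s \<in> \<Union>\<K>"
    then obtain K where K: "K \<in> \<K>" "s \<in> K" by auto
    then obtain x where "x \<in> D" "x \<in> K"
      using Scott_open_directed[OF _ D K(2)] * by auto
    then show "\<exists>x. x \<in> D \<and> x \<in> \<Union>\<K>" using K(1) by auto
  qed
qed

lemma openin_Scott_topology: "openin (Scott_topology L) W \<longleftrightarrow> Scott_open L W"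
  unfolding Scott_topology_def by (simp add: istopology_Scott_open topology_inverse')

lemma topspace_Scott_topology [simp]: "topspace (Scott_topology L) = L"
proof (rule antisym)
  show "topspace (Scott_topology L) \<subseteq> L"
    using openin_topspace[of "Scott_topology L"] openin_Scott_topology Scott_open_subset by metis
  have "Scott_open L L"
    by (rule Scott_openI) (auto simp: directed_set_def)
  then show "L \<subseteq> topspace (Scott_topology L)"
    using openin_Scott_topology openin_subset by metis
qed

subsection \<open>Spaces of open, closed, and compact saturated sets\<close>

definition opens_space :: "'a topology \<Rightarrow> 'a set topology" where
  "opens_space Y = Scott_topology {U. openin Y U}"

definition saturatedin :: "'a topology \<Rightarrow> 'a set \<Rightarrow> bool" where
  "saturatedin Y K \<longleftrightarrow> K = \<Inter>{U. openin Y U \<and> K \<subseteq> U}"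

definition Diamond :: "'a topology \<Rightarrow> 'a set \<Rightarrow> 'a set set" where
  "Diamond Y U = {A. closedin Y A \<and> A \<inter> U \<noteq> {}}"

definition Box :: "'a topology \<Rightarrow> 'a set \<Rightarrow> 'a set set" where
  "Box Y U = {K. compactin Y K \<and> saturatedin Y K \<and> K \<subseteq> U}"

text \<open>The empty closed set lies in no \<open>Diamond Y U\<close>, so the carrier of the lower Vietoris topology
  is given explicitly instead of being the union of the subbase.\<close>

definition lower_Vietoris :: "'a topology \<Rightarrow> 'a set topology" where
  "lower_Vietoris Y =
     topology (arbitrary union_of
       (finite intersection_of (\<lambda>W. \<exists>U. openin Y U \<and> W = Diamond Y U)
        relative_to {A. closedin Y A}))"

definition upper_Vietoris :: "'a topology \<Rightarrow> 'a set topology" where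
  "upper_Vietoris Y =
     topology (arbitrary union_of
       (finite intersection_of (\<lambda>W. \<exists>U. openin Y U \<and> W = Box Y U)
        relative_to {K. compactin Y K \<and> saturatedin Y K}))"

lemma topspace_opens_space [simp]: "topspace (opens_space Y) = {U. openin Y U}"
  by (simp add: opens_space_def)

lemma topspace_lower_Vietoris [simp]: "topspace (lower_Vietoris Y) = {A. closedin Y A}"
  by (simp add: lower_Vietoris_def)

lemma topspace_upper_Vietoris [simp]:
  "topspace (upper_Vietoris Y) = {K. compactin Y K \<and> saturatedin Y K}"
  by (simp add: upper_Vietoris_def)

subsection \<open>The comparison maps\<close>

definition alpha :: "'a topology \<Rightarrow> 'a set set \<Rightarrow> 'a set set" where
  "alpha X \<AA> = (\<Union>U\<in>\<AA>. Box X U)"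

definition beta :: "'a topology \<Rightarrow> 'a set set \<Rightarrow> 'a set set" where
  "beta X \<U> = {U. openin X U \<and> Box X U \<subseteq> \<U>}"

end

theory Submission
  imports Defs
begin

text \<open>Everything rests on consonance: a Scott-open family of open sets containing \<open>U\<close> contains
  all open neighbourhoods of some compact saturated \<open>K \<subseteq> U\<close>. To find \<open>K\<close> in a Smyth-complete
  quasi-metric space, shrink \<open>U\<close> within the family to finite unions of ever smaller balls, each
  ball lying well inside one of the preceding stage, and intersect. Consonance of \<open>X\<close> yields
  \<open>\<beta> \<circ> \<alpha> = id\<close> and the continuity of \<open>\<beta>\<close>; consonance of the finite sums of copies of \<open>X\<close> yields
  the continuity of \<open>\<alpha>\<close>.\<close>

section \<open>Directed families, Scott-open families of open sets, compactness\<close>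

lemma directed_set_finite_bound:
  assumes "directed_set D" "finite F" "F \<subseteq> D"
  shows "\<exists>z\<in>D. \<forall>x\<in>F. x \<le> z"
  using assms(2,3)
proof (induction F rule: finite_induct)
  case empty
  then show ?case using assms(1) by (auto simp: directed_set_def)
next
  case (insert a F)
  then obtain z where z: "z \<in> D" "\<forall>x\<in>F. x \<le> z" by auto
  obtain w where "w \<in> D" "a \<le> w" "z \<le> w"
    using assms(1) z(1) insert.prems unfolding directed_set_def by blast
  then show ?case using z by (metis insert_iff order_trans)
qed

text \<open>Replaces an arbitrary cover by a directed one, so that Scott openness can be tested
  against covers. The empty subfamily keeps the family nonempty when \<open>\<C>\<close> is
  empty.\<close>

lemma directed_set_finite_Unions: "directed_set (Union ` {F. finite F \<and> F \<subseteq> \<C>})"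
  unfolding directed_set_def
proof (intro conjI ballI)
  fix S T assume "S \<in> Union ` {F. finite F \<and> F \<subseteq> \<C>}" "T \<in> Union ` {F. finite F \<and> F \<subseteq> \<C>}"
  then obtain F G where "S = \<Union>F" "T = \<Union>G" "finite F" "finite G" "F \<subseteq> \<C>" "G \<subseteq> \<C>" by auto
  then show "\<exists>Z\<in>Union ` {F. finite F \<and> F \<subseteq> \<C>}. S \<subseteq> Z \<and> T \<subseteq> Z"
    by (intro bexI[of _ "\<Union>(F \<union> G)"] imageI) auto
qed auto

lemma Union_finite_Unions: "\<Union>(Union ` {F. finite F \<and> F \<subseteq> \<C>}) = \<Union>\<C>"
proof
  show "\<Union>\<C> \<subseteq> \<Union>(Union ` {F. finite F \<and> F \<subseteq> \<C>})"
  proof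
    fix x assume "x \<in> \<Union>\<C>"
    then obtain C where "C \<in> \<C>" "x \<in> C" by auto
    then show "x \<in> \<Union>(Union ` {F. finite F \<and> F \<subseteq> \<C>})" by (intro UN_I[of "{C}"]) auto
  qed
qed auto

text \<open>A union of open sets is open, hence is the least upper bound inside the lattice; this
  eliminates \<open>isLub\<close> from the work with families of open sets.\<close>

lemma isLub_openin_iff:
  assumes "D \<subseteq> {U. openin X U}"
  shows "isLub {U. openin X U} D s \<longleftrightarrow> s = \<Union>D"
proof -
  have "openin X (\<Union>D)" using assms by auto
  then show ?thesis
    unfolding isLub_def leastP_def isUb_def setle_def setge_def
    by (intro iffI antisym) auto
qed

lemma Scott_open_opensI:
  assumes "\<And>U. U \<in> H \<Longrightarrow> openin X U"
    and "\<And>U V. \<lbrakk>U \<in> H; openin X V; U \<subseteq> V\<rbrakk> \<Longrightarrow> V \<in> H"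
    and "\<And>D. \<lbrakk>\<And>U. U \<in> D \<Longrightarrow> openin X U; directed_set D; \<Union>D \<in> H\<rbrakk> \<Longrightarrow> \<exists>U\<in>D. U \<in> H"
  shows "Scott_open {U. openin X U} H"
proof (rule Scott_openI)
  show "H \<subseteq> {U. openin X U}" using assms(1) by auto
next
  show "V \<in> H" if "U \<in> H" "V \<in> {U. openin X U}" "U \<subseteq> V" for U V
    using assms(2) that by simp
next
  fix D s assume D: "D \<subseteq> {U. openin X U}" "directed_set D" "isLub {U. openin X U} D s" "s \<in> H"
  then have "\<Union>D \<in> H" by (simp add: isLub_openin_iff)
  with D(1,2) have "\<exists>U\<in>D. U \<in> H" by (intro assms(3)) auto
  then show "\<exists>x. x \<in> D \<and> x \<in> H" by blast
qed

text \<open>Scott openness makes membership in \<open>H\<close> behave like compactness: the union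
  of the cover is in \<open>H\<close> because it contains \<open>W\<close>, and it is a directed
  union of finite unions. The finite union found need not cover \<open>W\<close>.\<close>

lemma Scott_open_finite_subcover:
  assumes H: "Scott_open {U. openin X U} H" and "W \<in> H"
    and \<C>: "\<And>C. C \<in> \<C> \<Longrightarrow> openin X C" and "W \<subseteq> \<Union>\<C>"
  obtains F where "finite F" "F \<subseteq> \<C>" "\<Union>F \<in> H"
proof -
  let ?D = "Union ` {F. finite F \<and> F \<subseteq> \<C>}"
  have D: "?D \<subseteq> {U. openin X U}" using \<C> by auto
  have "\<Union>\<C> \<in> H"
    using Scott_open_upward[OF H \<open>W \<in> H\<close>, of "\<Union>\<C>"] \<C> assms(4) by auto
  then show thesis
    using Scott_open_directed[OF H D directed_set_finite_Unions, of "\<Union>\<C>"] that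
    by (auto simp: isLub_openin_iff[OF D] Union_finite_Unions)
qed

lemma compactin_directedD:
  assumes "compactin X K" "directed_set D" "\<And>U. U \<in> D \<Longrightarrow> openin X U" "K \<subseteq> \<Union>D"
  shows "\<exists>U\<in>D. K \<subseteq> U"
proof -
  obtain F where F: "finite F" "F \<subseteq> D" "K \<subseteq> \<Union>F"
    using assms unfolding compactin_def by metis
  then obtain U where "U \<in> D" "\<forall>V\<in>F. V \<subseteq> U"
    using directed_set_finite_bound[OF assms(2) F(1,2)] by auto
  then show ?thesis using F(3) by (meson Union_least order_trans)
qed

lemma compactin_directedI:
  assumes "K \<subseteq> topspace X"
    and "\<And>D. \<lbrakk>directed_set D; \<And>U. U \<in> D \<Longrightarrow> openin X U; K \<subseteq> \<Union>D\<rbrakk> \<Longrightarrow> \<exists>U\<in>D. K \<subseteq> U"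
  shows "compactin X K"
  unfolding compactin_def
proof (intro conjI allI impI)
  fix \<U> assume \<U>: "(\<forall>U\<in>\<U>. openin X U) \<and> K \<subseteq> \<Union>\<U>"
  then have "\<exists>U\<in>Union ` {F. finite F \<and> F \<subseteq> \<U>}. K \<subseteq> U"
    by (intro assms(2) directed_set_finite_Unions) (auto simp only: Union_finite_Unions)
  then show "\<exists>F. finite F \<and> F \<subseteq> \<U> \<and> K \<subseteq> \<Union>F" by auto
qed (fact assms(1))

text \<open>Compactness can be tested on directed covers. This is the easy half of the link between
  compact sets and Scott-open families; it makes the sets \<open>N U\<close> in the continuity of
  \<open>alpha\<close> Scott-open.\<close>

lemma Scott_open_compact_nbhds:
  assumes "compactin X K"
  shows "Scott_open {U. openin X U} {U. openin X U \<and> K \<subseteq> U}"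
proof (rule Scott_open_opensI)
  fix D assume D: "\<And>U. U \<in> D \<Longrightarrow> openin X U" "directed_set D"
    and "\<Union>D \<in> {U. openin X U \<and> K \<subseteq> U}"
  then obtain U where "U \<in> D" "K \<subseteq> U" using compactin_directedD[OF assms D(2,1)] by auto
  then show "\<exists>U\<in>D. U \<in> {U. openin X U \<and> K \<subseteq> U}" using D(1) by auto
qed auto

subsection \<open>Koenig's lemma\<close>

text \<open>If every element of the finite set failed at some stage, all of them would fail at the
  largest of these stages.\<close>

lemma finite_antimono_choice:
  fixes P :: "nat \<Rightarrow> 'b \<Rightarrow> bool"
  assumes "finite F" "\<And>k. \<exists>y\<in>F. P k y" "\<And>j k y. \<lbrakk>j \<le> k; P k y\<rbrakk> \<Longrightarrow> P j y"
  shows "\<exists>y\<in>F. \<forall>k. P k y"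
proof (rule ccontr)
  assume "\<not> ?thesis"
  then obtain m where m: "\<And>y. y \<in> F \<Longrightarrow> \<not> P (m y) y" by metis
  obtain y where y: "y \<in> F" "P (Max (m ` F)) y" using assms(2) by auto
  then have "m y \<le> Max (m ` F)" using assms(1) by auto
  then show False using m y assms(3) by blast
qed

text \<open>Depth-\<open>k\<close> approximation to being the start of an infinite branch. Levels
  and a relation are used rather than a tree, since a ball may have several parents.\<close>

primrec extensible :: "(nat \<Rightarrow> 'b set) \<Rightarrow> ('b \<Rightarrow> 'b \<Rightarrow> bool) \<Rightarrow> nat \<Rightarrow> nat \<Rightarrow> 'b set" where
  "extensible S R 0 n = S n"
| "extensible S R (Suc k) n = {x \<in> S n. \<exists>y\<in>extensible S R k (Suc n). R x y}"

lemma extensible_Suc_subset: "extensible S R (Suc k) n \<subseteq> extensible S R k n"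
proof (induction k arbitrary: n)
  case (Suc k)
  show ?case using Suc[of "Suc n"] by auto
qed auto

lemma extensible_antimono: "j \<le> k \<Longrightarrow> extensible S R k n \<subseteq> extensible S R j n"
  by (rule lift_Suc_antimono_le[of "\<lambda>k. extensible S R k n", OF extensible_Suc_subset])

lemma extensible_subset: "extensible S R k n \<subseteq> S n"
  by (cases k) auto

text \<open>Only points with paths of every finite length below them are followed. One exists at
  level 0, and each has a successor of the same kind, because the finitely many candidates thin out
  monotonically as the required length grows. Dependent choice then gives the branch.\<close>

lemma ex_branch_finite_levels:
  assumes fin: "\<And>n. finite (S n)" and ne: "\<And>n. S n \<noteq> {}"
    and parent: "\<And>n y. y \<in> S (Suc n) \<Longrightarrow> \<exists>x\<in>S n. R x y"
  shows "\<exists>f. \<forall>n::nat. f n \<in> S n \<and> R (f n) (f (Suc n))"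
proof -
  let ?A = "extensible S R"
  \<comment> \<open>Paths are built upwards: a point of level \<open>Suc n\<close> with
    \<open>k\<close> levels below it has a parent, and that parent has \<open>Suc k\<close>.\<close>
  have A_ne: "?A k n \<noteq> {}" for k n
  proof (induction k arbitrary: n)
    case (Suc k)
    then obtain y where "y \<in> ?A k (Suc n)" by blast
    moreover from this obtain x where "x \<in> S n" "R x y"
      using parent extensible_subset[of S R k "Suc n"] by blast
    ultimately show ?case by auto
  qed (simp add: ne)
  have "\<exists>x\<in>S 0. \<forall>k. x \<in> ?A k 0"
    using A_ne extensible_subset[of S R _ 0] extensible_antimono[of _ _ S R 0]
    by (intro finite_antimono_choice fin) blast+
  then have 0: "\<exists>x. \<forall>k. x \<in> ?A k 0" by blast
  have step: "\<exists>y. (\<forall>k. y \<in> ?A k (Suc n)) \<and> R x y" if x: "\<forall>k. x \<in> ?A k n" for x n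
  proof -
    have "\<exists>y\<in>S (Suc n). y \<in> ?A k (Suc n) \<and> R x y" for k
      using spec[OF x, of "Suc k"] extensible_subset[of S R k "Suc n"] by auto
    then have "\<exists>y\<in>S (Suc n). \<forall>k. y \<in> ?A k (Suc n) \<and> R x y"
      using extensible_antimono[of _ _ S R "Suc n"]
      by (intro finite_antimono_choice fin) blast+
    then show ?thesis by blast
  qed
  obtain f where f: "\<And>n. (\<forall>k. f n \<in> ?A k n) \<and> R (f n) (f (Suc n))"
    using dependent_nat_choice[of "\<lambda>n x. \<forall>k. x \<in> ?A k n" "\<lambda>_. R", OF 0 step] by auto
  then show ?thesis using extensible_subset by (metis subsetD)
qed

subsection \<open>Consonance of Smyth-complete quasi-metric spaces\<close>

text \<open>Together with \<open>Scott_open_compact_nbhds\<close> this says that the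
  open-neighbourhood families of compact saturated sets form a base of the Scott topology on the
  open sets.\<close>

definition consonant :: "'a topology \<Rightarrow> bool" where
  "consonant X \<longleftrightarrow> (\<forall>H U. Scott_open {U. openin X U} H \<and> U \<in> H \<longrightarrow>
     (\<exists>K\<in>Box X U. \<forall>V. openin X V \<and> K \<subseteq> V \<longrightarrow> V \<in> H))"

locale Smyth_complete_space =
  fixes X :: "'a topology" and d :: "'a \<Rightarrow> 'a \<Rightarrow> real"
  assumes quasi_metric: "quasi_metric_on (topspace X) d"
    and complete: "Smyth_complete_on (topspace X) d"
    and induces: "quasi_metric_induces d X"
begin

definition qball :: "'a \<times> real \<Rightarrow> 'a set" where
  "qball p = {y \<in> topspace X. d (fst p) y < snd p}"

text \<open>The strict order on formal balls. For centres in the space it implies inclusion of the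
  balls, and it leaves a positive slack that keeps limits of nested balls strictly inside
  them.\<close>

definition refines :: "'a \<times> real \<Rightarrow> 'a \<times> real \<Rightarrow> bool" where
  "refines p q \<longleftrightarrow> d (fst p) (fst q) + snd q < snd p"

lemma triangle:
  "\<lbrakk>x \<in> topspace X; y \<in> topspace X; z \<in> topspace X\<rbrakk> \<Longrightarrow> d x z \<le> d x y + d y z"
  using quasi_metric by (auto simp: quasi_metric_on_def)

lemma dist_nonneg: "\<lbrakk>x \<in> topspace X; y \<in> topspace X\<rbrakk> \<Longrightarrow> 0 \<le> d x y"
  using quasi_metric by (auto simp: quasi_metric_on_def)

lemma dist_self: "x \<in> topspace X \<Longrightarrow> d x x = 0"
  using quasi_metric by (auto simp: quasi_metric_on_def)

lemma openin_iff:
  "openin X U \<longleftrightarrow> U \<subseteq> topspace X \<and> (\<forall>x\<in>U. \<exists>e>0. qball (x, e) \<subseteq> U)"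
  using induces by (auto simp: quasi_metric_induces_def qball_def)

lemma refines_qball_subset:
  assumes "fst p \<in> topspace X" "fst q \<in> topspace X" "refines p q"
  shows "qball q \<subseteq> qball p"
  using assms triangle[of "fst p" "fst q"] unfolding qball_def refines_def by fastforce

lemma ex_refines:
  assumes "x \<in> qball p" "0 < b"
  shows "\<exists>e. 0 < e \<and> e \<le> b \<and> refines p (x, e)"
proof (intro exI conjI)
  \<comment> \<open>Half of the available slack keeps the inequality in \<open>refines\<close>
    strict.\<close>
  let ?e = "min b ((snd p - d (fst p) x) / 2)"
  show "0 < ?e" "refines p (x, ?e)"
    using assms by (auto simp: qball_def refines_def min_def field_simps)
qed simp

lemma openin_qball:
  assumes "fst p \<in> topspace X"
  shows "openin X (qball p)"
  unfolding openin_iff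
proof (intro conjI ballI)
  fix x assume x: "x \<in> qball p"
  then obtain e where "0 < e" "refines p (x, e)" using ex_refines[OF x, of 1] by auto
  then show "\<exists>e>0. qball (x, e) \<subseteq> qball p"
    using refines_qball_subset[OF assms, of "(x, e)"] x by (auto simp: qball_def)
qed (auto simp: qball_def)

text \<open>Later centres lie in earlier balls, so the centres are Cauchy. Both halves of the
  symmetrised convergence matter: \<open>d (s n) x\<close> tending to 0 puts \<open>x\<close> into
  every ball, \<open>d x (s n)\<close> tending to 0 lets each neighbourhood of \<open>x\<close>
  swallow a late ball.\<close>

lemma nested_qballs_limit:
  assumes top: "\<And>n. fst (f n) \<in> topspace X"
    and le: "\<And>n. snd (f n) \<le> (1/2) ^ n" and pos: "\<And>n. 0 < snd (f n)"
    and ref: "\<And>n. refines (f n) (f (Suc n))"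
  obtains x where "\<And>n. x \<in> qball (f n)" "\<And>V. \<lbrakk>openin X V; x \<in> V\<rbrakk> \<Longrightarrow> \<exists>n. qball (f n) \<subseteq> V"
proof -
  define s where "s n = fst (f n)" for n
  have sub: "qball (f m) \<subseteq> qball (f n)" if "n \<le> m" for n m
    using that
  proof (induction m rule: dec_induct)
    case (step m)
    then show ?case using refines_qball_subset[OF top top ref, of m] by blast
  qed simp
  have dlt: "d (s n) (s m) < snd (f n)" if "n \<le> m" for n m
  proof -
    have "s m \<in> qball (f m)" using top pos by (simp add: qball_def s_def dist_self)
    then show ?thesis using sub[OF that] by (auto simp: qball_def s_def)
  qed
  have "quasi_Cauchy d s"
    unfolding quasi_Cauchy_def
  proof (intro allI impI)
    fix e :: real assume "0 < e"
    then obtain N where N: "(1/2) ^ N < e" using real_arch_pow_inv[of e "1/2"] by auto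
    have "d (s n) (s m) < e" if "n \<ge> N" "m \<ge> n" for n m
    proof -
      have "(1/2) ^ n \<le> (1/2::real) ^ N" using that by (intro power_decreasing) auto
      then show ?thesis using dlt[OF that(2)] le[of n] N by linarith
    qed
    then show "\<exists>N. \<forall>n\<ge>N. \<forall>m\<ge>n. d (s n) (s m) < e" by blast
  qed
  moreover have "range s \<subseteq> topspace X" using top by (auto simp: s_def)
  ultimately obtain x where x: "x \<in> topspace X"
    and lim: "(\<lambda>n. max (d x (s n)) (d (s n) x)) \<longlonglongrightarrow> 0"
    using complete unfolding Smyth_complete_on_def by blast
  have ev: "\<forall>\<^sub>F n in sequentially. d x (s n) < e \<and> d (s n) x < e" if "0 < e" for e
    using order_tendstoD(2)[OF lim that] by eventually_elim auto
  show thesis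
  proof
    fix n
    \<comment> \<open>The slack between two consecutive balls. A centre \<open>s m\<close> that is
      closer than this to \<open>x\<close> gives a strict bound for \<open>d (s n) x\<close>, by way
      of \<open>s (Suc n)\<close> and \<open>s m\<close>.\<close>
    let ?g = "snd (f n) - (d (s n) (s (Suc n)) + snd (f (Suc n)))"
    have g: "0 < ?g" using ref[of n] by (simp add: refines_def s_def)
    have "\<forall>\<^sub>F m in sequentially. d (s m) x < ?g \<and> m \<ge> Suc n"
      using ev[OF g] eventually_ge_at_top[of "Suc n"] by eventually_elim auto
    then obtain m where m: "d (s m) x < ?g" "m \<ge> Suc n"
      using eventually_happens by fastforce
    have "d (s n) x \<le> d (s n) (s (Suc n)) + d (s (Suc n)) x"
      "d (s (Suc n)) x \<le> d (s (Suc n)) (s m) + d (s m) x"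
      using top x by (auto intro!: triangle simp: s_def)
    with dlt[OF m(2)] m(1) have "d (s n) x < snd (f n)" by linarith
    with x show "x \<in> qball (f n)" by (simp add: qball_def s_def)
  next
    fix V assume "openin X V" "x \<in> V"
    then obtain e where e: "0 < e" "qball (x, e) \<subseteq> V" by (auto simp: openin_iff)
    \<comment> \<open>One half of \<open>e\<close> is spent on the distance from \<open>x\<close> to
      the centre, the other on the radius.\<close>
    have "(\<lambda>n. (1/2::real) ^ n) \<longlonglongrightarrow> 0" by (rule LIMSEQ_power_zero) simp
    then have "\<forall>\<^sub>F n in sequentially. (1/2::real) ^ n < e/2"
      by (rule order_tendstoD) (use e in auto)
    then have "\<forall>\<^sub>F n in sequentially. d x (s n) < e/2 \<and> (1/2::real) ^ n < e/2"
      using ev[OF half_gt_zero[OF e(1)]] by eventually_elim auto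
    then obtain n where n: "d x (s n) < e/2" "(1/2) ^ n < e/2"
      using eventually_happens by fastforce
    have "qball (f n) \<subseteq> qball (x, e)"
    proof
      fix y assume y: "y \<in> qball (f n)"
      then have "d x y \<le> d x (s n) + d (s n) y"
        using top x by (auto intro!: triangle simp: s_def qball_def)
      with y n le[of n] show "y \<in> qball (x, e)" by (auto simp: qball_def s_def)
    qed
    then show "\<exists>n. qball (f n) \<subseteq> V" using e(2) by blast
  qed
qed

text \<open>One shrinking step: the balls centred in \<open>W\<close> with property \<open>Q\<close>
  cover \<open>W\<close>, and finitely many of them suffice for membership in
  \<open>H\<close>.\<close>

lemma Scott_open_finite_qballs:
  assumes H: "Scott_open {U. openin X U} H" and "W \<in> H"
    and small: "\<forall>x\<in>W. \<exists>e>0. Q (x, e)"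
  shows "\<exists>L. finite L \<and> (\<forall>p\<in>L. fst p \<in> W \<and> 0 < snd p \<and> Q p) \<and> \<Union>(qball ` L) \<in> H"
proof -
  have W: "openin X W" using Scott_open_subset[OF H] \<open>W \<in> H\<close> by auto
  let ?N = "{p. fst p \<in> W \<and> 0 < snd p \<and> Q p}"
  have cover: "W \<subseteq> \<Union>(qball ` ?N)"
  proof
    fix x assume x: "x \<in> W"
    then obtain e where "0 < e" "Q (x, e)" using small by blast
    moreover from this x have "x \<in> qball (x, e)"
      using openin_subset[OF W] by (auto simp: qball_def dist_self)
    ultimately show "x \<in> \<Union>(qball ` ?N)" using x by (intro UN_I[of "(x, e)"]) auto
  qed
  have "openin X C" if "C \<in> qball ` ?N" for C
    using that openin_subset[OF W] openin_qball by auto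
  then obtain F where F: "finite F" "F \<subseteq> qball ` ?N" "\<Union>F \<in> H"
    by (rule Scott_open_finite_subcover[OF H \<open>W \<in> H\<close> _ cover])
  obtain L where L: "L \<subseteq> ?N" "finite L" "F = qball ` L"
    using finite_subset_image[OF F(1,2)] by auto
  show ?thesis using L F(3) by (intro exI[of _ L]) auto
qed

lemma ex_refining_levels:
  assumes H: "Scott_open {U. openin X U} H" and "U \<in> H"
  obtains L where "\<And>n. finite (L n)" "\<And>n. \<Union>(qball ` L n) \<in> H" "\<Union>(qball ` L 0) \<subseteq> U"
    "\<And>n p. p \<in> L n \<Longrightarrow> fst p \<in> topspace X \<and> 0 < snd p \<and> snd p \<le> (1/2) ^ n"
    "\<And>n q. q \<in> L (Suc n) \<Longrightarrow> \<exists>p\<in>L n. refines p q"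
proof -
  \<comment> \<open>The requirements on a single level. Only level 0 has to be placed inside
    \<open>U\<close> explicitly; the relation between successive levels is left to dependent
    choice.\<close>
  define P where "P n L \<longleftrightarrow> finite L \<and> \<Union>(qball ` L) \<in> H \<and> (n = 0 \<longrightarrow> \<Union>(qball ` L) \<subseteq> U) \<and>
    (\<forall>p\<in>L. fst p \<in> topspace X \<and> 0 < snd p \<and> snd p \<le> (1/2) ^ n)" for n :: nat and L
  have Hop: "openin X W" if "W \<in> H" for W using Scott_open_subset[OF H] that by auto
  \<comment> \<open>The bound 1 is \<open>(1/2) ^ 0\<close>, as required at level 0.\<close>
  have "\<forall>x\<in>U. \<exists>e>0. qball (x, e) \<subseteq> U \<and> snd (x, e) \<le> 1"
  proof
    fix x assume "x \<in> U"
    then obtain e where "e > 0" "qball (x, e) \<subseteq> U"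
      using Hop[OF \<open>U \<in> H\<close>] unfolding openin_iff by blast
    then show "\<exists>e>0. qball (x, e) \<subseteq> U \<and> snd (x, e) \<le> 1"
      by (intro exI[of _ "min e 1"]) (auto simp: qball_def)
  qed
  from Scott_open_finite_qballs[OF H \<open>U \<in> H\<close>, of "\<lambda>p. qball p \<subseteq> U \<and> snd p \<le> 1", OF this]
  obtain L where "finite L" "\<Union>(qball ` L) \<in> H"
    "\<forall>p\<in>L. fst p \<in> U \<and> 0 < snd p \<and> qball p \<subseteq> U \<and> snd p \<le> 1"
    by (elim exE conjE)
  then have "P 0 L" using openin_subset[OF Hop[OF \<open>U \<in> H\<close>]] by (auto simp: P_def)
  then have 0: "\<exists>L. P 0 L" by blast
  have step: "\<exists>L'. P (Suc n) L' \<and> (\<forall>q\<in>L'. \<exists>p\<in>L. refines p q)" if L: "P n L" for n L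
  proof -
    have W: "\<Union>(qball ` L) \<in> H" using L by (simp add: P_def)
    \<comment> \<open>Each such point lies in a ball of level \<open>n\<close>, which is refined by
      a small enough ball around the point.\<close>
    have "\<forall>x\<in>\<Union>(qball ` L). \<exists>e>0. snd (x, e) \<le> (1/2) ^ Suc n \<and> (\<exists>p\<in>L. refines p (x, e))"
      using ex_refines[of _ _ "(1/2) ^ Suc n"] by (simp del: power_Suc) blast
    from Scott_open_finite_qballs[OF H W,
        of "\<lambda>q. snd q \<le> (1/2) ^ Suc n \<and> (\<exists>p\<in>L. refines p q)", OF this]
    obtain L' where L': "finite L'" "\<Union>(qball ` L') \<in> H"
      "\<forall>q\<in>L'. fst q \<in> \<Union>(qball ` L) \<and> 0 < snd q \<and>
         snd q \<le> (1/2) ^ Suc n \<and> (\<exists>p\<in>L. refines p q)"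
      by (elim exE conjE)
    then have "P (Suc n) L'"
      using subsetD[OF openin_subset[OF Hop[OF W]]] by (simp only: P_def) simp
    then show ?thesis using L'(3) by blast
  qed
  obtain L where "\<forall>n. P n (L n) \<and> (\<forall>q\<in>L (Suc n). \<exists>p\<in>L n. refines p q)"
    using dependent_nat_choice[of P "\<lambda>_ L L'. \<forall>q\<in>L'. \<exists>p\<in>L. refines p q", OF 0 step] by blast
  then show thesis by (intro that[of L]) (simp_all add: P_def)
qed

text \<open>By Koenig's lemma, a failing directed cover would yield a nested sequence of balls, none
  contained in a member of the cover; its Smyth limit lies in the intersection, hence in some
  member of the cover, and that member swallows a late ball.\<close>

lemma refining_levels_directed_cover:
  assumes fin: "\<And>n. finite (L n)"
    and L: "\<And>n p. p \<in> L n \<Longrightarrow> fst p \<in> topspace X \<and> 0 < snd p \<and> snd p \<le> (1/2) ^ n"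
    and parent: "\<And>n q. q \<in> L (Suc n) \<Longrightarrow> \<exists>p\<in>L n. refines p q"
    and D: "directed_set D" "\<And>V. V \<in> D \<Longrightarrow> openin X V"
    and cover: "(\<Inter>n. \<Union>(qball ` L n)) \<subseteq> \<Union>D"
  shows "\<exists>n. \<exists>V\<in>D. \<Union>(qball ` L n) \<subseteq> V"
proof (rule ccontr)
  assume contr: "\<not> ?thesis"
  \<comment> \<open>The bad balls. Directedness bounds finitely many members of \<open>D\<close> by
    one, so no \<open>S n\<close> is empty; a ball that contains a bad ball is bad, so parents stay
    in \<open>S\<close>.\<close>
  define S where "S n = {p \<in> L n. \<not> (\<exists>V\<in>D. qball p \<subseteq> V)}" for n
  have "S n \<noteq> {}" for n
  proof
    assume "S n = {}"
    then have "\<forall>p\<in>L n. \<exists>V. V \<in> D \<and> qball p \<subseteq> V" unfolding S_def by blast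
    then obtain V where V: "\<And>p. p \<in> L n \<Longrightarrow> V p \<in> D \<and> qball p \<subseteq> V p" by metis
    then have "V ` L n \<subseteq> D" by blast
    then obtain W where "W \<in> D" "\<forall>x\<in>V ` L n. x \<subseteq> W"
      using directed_set_finite_bound[OF D(1), of "V ` L n"] fin by blast
    moreover from this have "qball p \<subseteq> W" if "p \<in> L n" for p
      using V[OF that] that by (meson imageI order_trans)
    ultimately show False using contr by (meson UN_least)
  qed
  moreover have "\<exists>p\<in>S n. refines p q" if "q \<in> S (Suc n)" for n q
  proof -
    have q: "q \<in> L (Suc n)" using that by (simp add: S_def)
    then obtain p where p: "p \<in> L n" "refines p q" using parent by blast
    then have "qball q \<subseteq> qball p" using L q by (intro refines_qball_subset) auto
    then have "p \<in> S n" using p(1) that unfolding S_def by (auto dest: order_trans)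
    then show ?thesis using p(2) by blast
  qed
  moreover have "finite (S n)" for n using fin by (simp add: S_def)
  ultimately obtain f where f: "\<And>n. f n \<in> S n \<and> refines (f n) (f (Suc n))"
    using ex_branch_finite_levels[of S refines] by blast
  then have fL: "f n \<in> L n" for n by (auto simp: S_def)
  obtain x where x: "\<And>n. x \<in> qball (f n)"
    "\<And>V. \<lbrakk>openin X V; x \<in> V\<rbrakk> \<Longrightarrow> \<exists>n. qball (f n) \<subseteq> V"
    using nested_qballs_limit[of f] f L[OF fL] by metis
  have "x \<in> \<Union>D" using x(1) fL cover by blast
  then obtain V where V: "V \<in> D" "x \<in> V" by blast
  then obtain n where "qball (f n) \<subseteq> V" using x(2) D(2) by blast
  then show False using f[of n] V(1) by (auto simp: S_def)
qed

lemma consonant: "consonant X"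
  unfolding consonant_def
proof (intro allI impI, elim conjE)
  fix H U assume H: "Scott_open {U. openin X U} H" and "U \<in> H"
  obtain L where L: "\<And>n. finite (L n)" "\<And>n. \<Union>(qball ` L n) \<in> H" "\<Union>(qball ` L 0) \<subseteq> U"
    "\<And>n p. p \<in> L n \<Longrightarrow> fst p \<in> topspace X \<and> 0 < snd p \<and> snd p \<le> (1/2) ^ n"
    "\<And>n q. q \<in> L (Suc n) \<Longrightarrow> \<exists>p\<in>L n. refines p q"
    using ex_refining_levels[OF H \<open>U \<in> H\<close>] by metis
  let ?K = "\<Inter>n. \<Union>(qball ` L n)"
  have opL: "openin X (\<Union>(qball ` L n))" for n using Scott_open_subset[OF H] L(2) by blast
  \<comment> \<open>Used twice: arbitrary directed covers give compactness of \<open>?K\<close>, and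
    the cover \<open>{V}\<close> puts a whole level, which is a member of \<open>H\<close>, inside
    \<open>V\<close>.\<close>
  have cover: "\<exists>n. \<exists>V\<in>D. \<Union>(qball ` L n) \<subseteq> V"
    if "directed_set D" "\<And>V. V \<in> D \<Longrightarrow> openin X V" "?K \<subseteq> \<Union>D" for D
    by (rule refining_levels_directed_cover[of L]) (fact L(1) L(4) L(5) that)+
  have "compactin X ?K"
  proof (rule compactin_directedI)
    show "?K \<subseteq> topspace X" using openin_subset[OF opL] by blast
  next
    fix D assume "directed_set D" "\<And>U. U \<in> D \<Longrightarrow> openin X U" "?K \<subseteq> \<Union>D"
    from cover[OF this] show "\<exists>U\<in>D. ?K \<subseteq> U" by blast
  qed
  moreover have "saturatedin X ?K"
    unfolding saturatedin_def using opL by (intro antisym) blast+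
  ultimately have "?K \<in> Box X U" using L(3) by (auto simp: Box_def)
  moreover have "V \<in> H" if V: "openin X V" "?K \<subseteq> V" for V
  proof -
    have "\<exists>n. \<exists>V'\<in>{V}. \<Union>(qball ` L n) \<subseteq> V'"
      using V by (intro cover) (auto simp: directed_set_def)
    then show ?thesis using Scott_open_upward[OF H L(2)] V(1) by auto
  qed
  ultimately show "\<exists>K\<in>Box X U. \<forall>V. openin X V \<and> K \<subseteq> V \<longrightarrow> V \<in> H" by blast
qed

end

section \<open>Sums of copies of a space\<close>

text \<open>Truncation at 1 saves the triangle inequality, as a detour through another summand costs
  2. A Cauchy sequence eventually stays in one copy of \<open>X\<close>, where completeness
  applies.\<close>

lemma Smyth_complete_space_sum:
  assumes "Smyth_complete_space X d"
  shows "Smyth_complete_space (sum_topology (\<lambda>_. X) I)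
           (\<lambda>p q. if fst p = fst q then min 1 (d (snd p) (snd q)) else 1)"
    (is "Smyth_complete_space ?S ?d")
proof
  interpret Smyth_complete_space X d by fact
  show "quasi_metric_on (topspace ?S) ?d"
    unfolding quasi_metric_on_def
  proof (intro conjI ballI)
    fix p q assume pq: "p \<in> topspace ?S" "q \<in> topspace ?S"
    then show "0 \<le> ?d p q" by (auto simp: dist_nonneg)
    have "snd p = snd q \<longleftrightarrow> d (snd p) (snd q) = 0 \<and> d (snd q) (snd p) = 0"
      using quasi_metric pq by (auto simp: quasi_metric_on_def)
    then show "p = q \<longleftrightarrow> ?d p q = 0 \<and> ?d q p = 0" by (auto simp: prod_eq_iff min_def)
  next
    fix p q r assume *: "p \<in> topspace ?S" "q \<in> topspace ?S" "r \<in> topspace ?S"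
    then have "0 \<le> d (snd p) (snd q)" "0 \<le> d (snd q) (snd r)" by (auto simp: dist_nonneg)
    moreover have "d (snd p) (snd r) \<le> d (snd p) (snd q) + d (snd q) (snd r)"
      using * by (intro triangle) auto
    ultimately show "?d p r \<le> ?d p q + ?d q r" by (auto simp: min_def)
  qed
  show "Smyth_complete_on (topspace ?S) ?d"
    unfolding Smyth_complete_on_def
  proof (intro allI impI, elim conjE)
    fix \<sigma> assume rng: "range \<sigma> \<subseteq> topspace ?S" and Cau: "quasi_Cauchy ?d \<sigma>"
    \<comment> \<open>Below \<open>min 1 e\<close> the value is neither the constant 1 nor
      truncated.\<close>
    have small: "fst p = fst q" "d (snd p) (snd q) < e" if "?d p q < min 1 e" for p q e
      using that by (auto split: if_splits)
    obtain N where N: "\<And>n m. \<lbrakk>n \<ge> N; m \<ge> n\<rbrakk> \<Longrightarrow> ?d (\<sigma> n) (\<sigma> m) < min 1 1"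
      using Cau unfolding quasi_Cauchy_def by (metis min.idem zero_less_one)
    have const: "fst (\<sigma> n) = fst (\<sigma> N)" if "n \<ge> N" for n
      using small(1)[OF N[of N n]] that by simp
    have "quasi_Cauchy d (snd \<circ> \<sigma>)"
      unfolding quasi_Cauchy_def
    proof (intro allI impI)
      fix e :: real assume "0 < e"
      then have "0 < min 1 e" by simp
      then obtain M where "\<And>n m. \<lbrakk>n \<ge> M; m \<ge> n\<rbrakk> \<Longrightarrow> ?d (\<sigma> n) (\<sigma> m) < min 1 e"
        using Cau unfolding quasi_Cauchy_def by meson
      then show "\<exists>M. \<forall>n\<ge>M. \<forall>m\<ge>n. d ((snd \<circ> \<sigma>) n) ((snd \<circ> \<sigma>) m) < e"
        using small(2) unfolding o_def by meson
    qed
    moreover have "range (snd \<circ> \<sigma>) \<subseteq> topspace X" using rng by auto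
    ultimately obtain x where x: "x \<in> topspace X"
      and lim: "(\<lambda>n. max (d x ((snd \<circ> \<sigma>) n)) (d ((snd \<circ> \<sigma>) n) x)) \<longlonglongrightarrow> 0"
      using complete unfolding Smyth_complete_on_def by blast
    let ?p = "(fst (\<sigma> N), x)"
    have "\<sigma> N \<in> topspace ?S" using rng by blast
    then have p: "?p \<in> topspace ?S" using x by auto
    have "(\<lambda>n. max (?d ?p (\<sigma> n)) (?d (\<sigma> n) ?p)) \<longlonglongrightarrow> 0"
    proof (rule Lim_null_comparison[OF _ lim])
      show "\<forall>\<^sub>F n in sequentially. norm (max (?d ?p (\<sigma> n)) (?d (\<sigma> n) ?p))
              \<le> max (d x ((snd \<circ> \<sigma>) n)) (d ((snd \<circ> \<sigma>) n) x)"
        using eventually_ge_at_top[of N]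
      proof eventually_elim
        case (elim n)
        have "\<sigma> n \<in> topspace ?S" using rng by blast
        then have "snd (\<sigma> n) \<in> topspace X" by auto
        then have "0 \<le> d x (snd (\<sigma> n))" "0 \<le> d (snd (\<sigma> n)) x" using x by (auto simp: dist_nonneg)
        then show ?case using const[OF elim] by (auto simp: max_def min_def)
      qed
    qed
    with p show "\<exists>p\<in>topspace ?S. (\<lambda>n. max (?d p (\<sigma> n)) (?d (\<sigma> n) p)) \<longlonglongrightarrow> 0" by blast
  qed
  show "quasi_metric_induces ?d ?S"
    unfolding quasi_metric_induces_def
  proof (intro allI iffI conjI ballI)
    fix U assume "openin ?S U"
    then show "U \<subseteq> topspace ?S" by (rule openin_subset)
  next
    fix U p assume U: "openin ?S U" and p: "p \<in> U"
    obtain i x where px: "p = (i, x)" by (cases p)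
    have i: "i \<in> I" using openin_subset[OF U] p px by auto
    then have "openin X {y. (i, y) \<in> U}" using U by (simp add: openin_sum_topology)
    then obtain e where e: "0 < e" "qball (x, e) \<subseteq> {y. (i, y) \<in> U}"
      using p px unfolding openin_iff by auto
    \<comment> \<open>Radius at most 1 confines the ball to the summand \<open>i\<close>.\<close>
    then have "{q \<in> topspace ?S. ?d p q < min 1 e} \<subseteq> U"
      by (auto simp: px qball_def split: if_splits)
    then show "\<exists>e>0. {q \<in> topspace ?S. ?d p q < e} \<subseteq> U"
      using e(1) by (intro exI[of _ "min 1 e"]) auto
  next
    fix U assume U: "U \<subseteq> topspace ?S \<and> (\<forall>p\<in>U. \<exists>e>0. {q \<in> topspace ?S. ?d p q < e} \<subseteq> U)"
    have "openin X {x. (i, x) \<in> U}" if i: "i \<in> I" for i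
      unfolding openin_iff
    proof (intro conjI ballI)
      fix x assume x: "x \<in> {x. (i, x) \<in> U}"
      then obtain e where e: "0 < e" "{q \<in> topspace ?S. ?d (i, x) q < e} \<subseteq> U"
        using U by blast
      then have "qball (x, e) \<subseteq> {x. (i, x) \<in> U}"
        using i by (auto simp: qball_def subset_iff)
      then show "\<exists>e>0. qball (x, e) \<subseteq> {x. (i, x) \<in> U}" using e(1) by blast
    qed (use U in auto)
    then show "openin ?S U" using U by (simp add: openin_sum_topology)
  qed
qed

text \<open>A summand is closed, so its part of \<open>K\<close> is compact, and \<open>snd\<close>
  maps that part continuously onto the slice. Outside \<open>I\<close> the slice is empty.\<close>

lemma compactin_sum_slice:
  assumes K: "compactin (sum_topology (\<lambda>_. X) I) K"
  shows "compactin X {x. (i, x) \<in> K}"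
proof (cases "i \<in> I")
  case True
  let ?S = "sum_topology (\<lambda>_. X) I"
  have "closedin ?S ({i} \<times> topspace X)"
    using closedin_disjoint_union[of "\<lambda>_. X" I "\<lambda>j. if j = i then topspace X else {}"] True
    by (auto simp: Sigma_def elim!: back_subst[of "closedin ?S"] split: if_splits)
  then have "compactin ?S (({i} \<times> topspace X) \<inter> K)" using K by (rule closed_Int_compactin)
  moreover have "continuous_map ?S X snd"
    unfolding continuous_map_def
  proof (intro conjI allI impI)
    fix U assume U: "openin X U"
    then have "{p \<in> topspace ?S. snd p \<in> U} = I \<times> U" using openin_subset by force
    then show "openin ?S {p \<in> topspace ?S. snd p \<in> U}" using U by (simp add: openin_disjoint_union)
  qed auto
  ultimately have "compactin X (snd ` (({i} \<times> topspace X) \<inter> K))" by (rule image_compactin)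
  moreover have "snd ` (({i} \<times> topspace X) \<inter> K) = {x. (i, x) \<in> K}"
    using compactin_subset_topspace[OF K] by force
  ultimately show ?thesis by simp
next
  case False
  then have "{x. (i, x) \<in> K} = {}" using compactin_subset_topspace[OF K] by auto
  then show ?thesis by simp
qed

subsection \<open>The Vietoris topologies\<close>

lemma Box_mono: "U \<subseteq> V \<Longrightarrow> Box X U \<subseteq> Box X V"
  by (auto simp: Box_def)

text \<open>A compact set inside a directed union lies in one member.\<close>

lemma Box_directed_Union:
  assumes "directed_set D" "\<And>U. U \<in> D \<Longrightarrow> openin X U"
  shows "Box X (\<Union>D) = (\<Union>U\<in>D. Box X U)"
proof
  show "Box X (\<Union>D) \<subseteq> (\<Union>U\<in>D. Box X U)"
    using compactin_directedD[OF _ assms] by (auto simp: Box_def)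
qed (auto simp: Box_def)

lemma openin_Box:
  assumes "openin X U"
  shows "openin (upper_Vietoris X) (Box X U)"
  unfolding upper_Vietoris_def openin_subbase
proof (rule arbitrary_union_of_inc, rule relative_to_subset_inc)
  show "(finite intersection_of (\<lambda>W. \<exists>U. openin X U \<and> W = Box X U)) (Box X U)"
    using assms by (intro finite_intersection_of_inc) blast
qed (simp add: Box_def Collect_mono_iff)

lemma openin_Diamond:
  assumes "openin Y U"
  shows "openin (lower_Vietoris Y) (Diamond Y U)"
  unfolding lower_Vietoris_def openin_subbase
proof (rule arbitrary_union_of_inc, rule relative_to_subset_inc)
  show "(finite intersection_of (\<lambda>W. \<exists>U. openin Y U \<and> W = Diamond Y U)) (Diamond Y U)"
    using assms by (intro finite_intersection_of_inc) blast
qed (simp add: Diamond_def Collect_mono_iff)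

text \<open>Boxes of \<open>U\<close> and \<open>V\<close> intersect in the box of
  \<open>U \<inter> V\<close>, and the carrier is the box of the whole space, so the subbase is
  already a base.\<close>

lemma openin_upper_Vietoris_Box_nbhd:
  assumes W: "openin (upper_Vietoris X) W" and K: "K \<in> W"
  shows "\<exists>U. openin X U \<and> K \<in> Box X U \<and> Box X U \<subseteq> W"
proof -
  let ?T = "{K. compactin X K \<and> saturatedin X K}"
  let ?B = "\<lambda>W. \<exists>U. openin X U \<and> W = Box X U"
  obtain F where F: "finite F" "F \<subseteq> Collect ?B" "K \<in> ?T \<inter> \<Inter>F" "?T \<inter> \<Inter>F \<subseteq> W"
  proof -
    obtain \<V> where "\<V> \<subseteq> Collect (finite intersection_of ?B relative_to ?T)" "\<Union>\<V> = W"
      using W unfolding upper_Vietoris_def openin_subbase by (auto simp: union_of_def)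
    then obtain V where V: "(finite intersection_of ?B relative_to ?T) V" "K \<in> V" "V \<subseteq> W"
      using K by auto
    then obtain G where "(finite intersection_of ?B) G" "?T \<inter> G = V"
      unfolding relative_to_def by (elim exE conjE)
    then obtain F where "finite F" "F \<subseteq> Collect ?B" "?T \<inter> \<Inter>F = V"
      unfolding intersection_of_def by (elim exE conjE) simp
    then show thesis using V by (intro that[of F]) simp_all
  qed
  have "\<exists>U. openin X U \<and> ?T \<inter> \<Inter>F = Box X U"
    using F(1,2)
  proof (induction F rule: finite_induct)
    case empty
    have "?T = Box X (topspace X)" by (auto simp: Box_def dest: compactin_subset_topspace)
    then show ?case by auto
  next
    case (insert a F)
    then obtain U V where UV: "openin X U" "?T \<inter> \<Inter>F = Box X U" "openin X V" "a = Box X V"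
      by auto
    have "?T \<inter> \<Inter>(insert a F) = Box X (U \<inter> V)"
    proof -
      have "?T \<inter> \<Inter>(insert a F) = a \<inter> (?T \<inter> \<Inter>F)" by auto
      also have "\<dots> = Box X (U \<inter> V)" unfolding UV by (auto simp: Box_def)
      finally show ?thesis .
    qed
    then show ?case using UV by blast
  qed
  then show ?thesis using F(3,4) by metis
qed

subsection \<open>The comparison maps\<close>

lemma openin_opens_space: "openin (opens_space X) H \<longleftrightarrow> Scott_open {U. openin X U} H"
  by (simp add: opens_space_def openin_Scott_topology)

lemma closedin_opens_space:
  "closedin (opens_space X) \<AA> \<longleftrightarrow>
     \<AA> \<subseteq> {U. openin X U} \<and> Scott_open {U. openin X U} ({U. openin X U} - \<AA>)"
  by (simp add: closedin_def openin_opens_space)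

lemma openin_alpha:
  assumes "closedin (opens_space X) \<AA>"
  shows "openin (upper_Vietoris X) (alpha X \<AA>)"
proof -
  have "openin (upper_Vietoris X) C" if "C \<in> Box X ` \<AA>" for C
    using assms that openin_Box by (auto simp: closedin_opens_space)
  then show ?thesis unfolding alpha_def by (rule openin_Union)
qed

text \<open>By \<open>Box_directed_Union\<close>, if the boxes of all members of a directed family
  lie in \<open>\<U>\<close>, so does the box of the union; smaller open sets have smaller
  boxes.\<close>

lemma closedin_beta: "closedin (opens_space X) (beta X \<U>)"
  unfolding closedin_opens_space
proof
  show "Scott_open {U. openin X U} ({U. openin X U} - beta X \<U>)"
  proof (rule Scott_open_opensI)
    fix D assume D: "\<And>U. U \<in> D \<Longrightarrow> openin X U" "directed_set D"
      and "\<Union>D \<in> {U. openin X U} - beta X \<U>"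
    then have "\<not> (\<Union>U\<in>D. Box X U) \<subseteq> \<U>"
      by (simp add: beta_def Box_directed_Union[OF D(2,1)])
    then show "\<exists>U\<in>D. U \<in> {U. openin X U} - beta X \<U>"
      using D(1) by (auto simp: beta_def)
  next
    fix U V assume "U \<in> {U. openin X U} - beta X \<U>" "openin X V" "U \<subseteq> V"
    then show "V \<in> {U. openin X U} - beta X \<U>"
      using Box_mono[of U V X] by (auto simp: beta_def)
  qed simp
qed (auto simp: beta_def)

text \<open>Boxes form a base, so an open set is the union of the boxes inside it.\<close>

lemma alpha_beta:
  assumes "openin (upper_Vietoris X) \<U>"
  shows "alpha X (beta X \<U>) = \<U>"
proof
  show "\<U> \<subseteq> alpha X (beta X \<U>)"
  proof
    fix K assume "K \<in> \<U>"
    then obtain U where "openin X U" "K \<in> Box X U" "Box X U \<subseteq> \<U>"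
      using openin_upper_Vietoris_Box_nbhd[OF assms] by metis
    then show "K \<in> alpha X (beta X \<U>)" by (auto simp: alpha_def beta_def)
  qed
qed (auto simp: alpha_def beta_def)

text \<open>If \<open>U\<close> were outside \<open>\<AA>\<close>, consonance applied to the
  Scott-open complement would give a \<open>K\<close> in the box of \<open>U\<close> with all its
  open neighbourhoods outside \<open>\<AA>\<close>; but \<open>K\<close>, being in
  \<open>alpha X \<AA>\<close>, has a neighbourhood in \<open>\<AA>\<close>.\<close>

lemma beta_alpha:
  assumes "consonant X" and \<AA>: "closedin (opens_space X) \<AA>"
  shows "beta X (alpha X \<AA>) = \<AA>"
proof
  show "\<AA> \<subseteq> beta X (alpha X \<AA>)"
    using \<AA> by (auto simp: closedin_opens_space alpha_def beta_def)
  show "beta X (alpha X \<AA>) \<subseteq> \<AA>"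
  proof (rule subsetI, rule ccontr)
    fix U assume U: "U \<in> beta X (alpha X \<AA>)" "U \<notin> \<AA>"
    then have "U \<in> {U. openin X U} - \<AA>" by (simp add: beta_def)
    then obtain K where K: "K \<in> Box X U"
      "\<And>V. \<lbrakk>openin X V; K \<subseteq> V\<rbrakk> \<Longrightarrow> V \<in> {U. openin X U} - \<AA>"
      using assms unfolding consonant_def closedin_opens_space by meson
    then have "K \<in> alpha X \<AA>" using U by (auto simp: beta_def)
    then obtain V where "V \<in> \<AA>" "K \<subseteq> V" by (auto simp: alpha_def Box_def)
    then show False using K(2) \<AA> by (auto simp: closedin_opens_space)
  qed
qed

section \<open>Continuity of the comparison maps\<close>

text \<open>Consonance replaces a whole box by a single point of it. A \<open>K\<close> whose open
  neighbourhoods are all in \<open>H\<close> lies in one member of the directed family, and a box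
  around \<open>K\<close> inside that member comes from an open set in \<open>H\<close>.\<close>

lemma continuous_map_beta:
  assumes "consonant X"
  shows "continuous_map (opens_space (upper_Vietoris X)) (lower_Vietoris (opens_space X)) (beta X)"
  unfolding lower_Vietoris_def
proof (rule continuous_map_into_topology_subbase)
  fix \<U>
  show "beta X \<U> \<in> topspace (topology (arbitrary union_of (finite intersection_of
      (\<lambda>W. \<exists>U. openin (opens_space X) U \<and> W = Diamond (opens_space X) U)
      relative_to {A. closedin (opens_space X) A})))"
    using closedin_beta by simp
next
  fix S assume "\<exists>H. openin (opens_space X) H \<and> S = Diamond (opens_space X) H"
  then obtain H where H: "Scott_open {U. openin X U} H" and S: "S = Diamond (opens_space X) H"
    by (auto simp: openin_opens_space)
  have "{\<U> \<in> topspace (opens_space (upper_Vietoris X)). beta X \<U> \<in> S} =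
      {\<U>. openin (upper_Vietoris X) \<U> \<and> (\<exists>U\<in>H. Box X U \<subseteq> \<U>)}"
    using Scott_open_subset[OF H] closedin_beta[of X] by (auto simp: S Diamond_def beta_def)
  moreover have "Scott_open {\<U>. openin (upper_Vietoris X) \<U>} \<dots>"
  proof (rule Scott_open_opensI)
    fix D assume D: "\<And>\<U>. \<U> \<in> D \<Longrightarrow> openin (upper_Vietoris X) \<U>"
      and "\<Union>D \<in> {\<U>. openin (upper_Vietoris X) \<U> \<and> (\<exists>U\<in>H. Box X U \<subseteq> \<U>)}"
    then obtain U where U: "U \<in> H" "Box X U \<subseteq> \<Union>D" by auto
    then obtain K where K: "K \<in> Box X U" "\<And>V. \<lbrakk>openin X V; K \<subseteq> V\<rbrakk> \<Longrightarrow> V \<in> H"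
      using assms H unfolding consonant_def by meson
    then obtain \<U> where \<U>: "\<U> \<in> D" "K \<in> \<U>" using U by auto
    then obtain V where "openin X V" "K \<in> Box X V" "Box X V \<subseteq> \<U>"
      using openin_upper_Vietoris_Box_nbhd[OF D] by metis
    then have "V \<in> H" "Box X V \<subseteq> \<U>" using K(2) by (auto simp: Box_def)
    then show "\<exists>\<U>\<in>D. \<U> \<in> {\<U>. openin (upper_Vietoris X) \<U> \<and> (\<exists>U\<in>H. Box X U \<subseteq> \<U>)}"
      using \<U>(1) D by auto
  qed auto
  ultimately show "openin (opens_space (upper_Vietoris X))
      {\<U> \<in> topspace (opens_space (upper_Vietoris X)). beta X \<U> \<in> S}"
    by (simp add: openin_opens_space)
qed

text \<open>An open set of the sum is an \<open>I\<close>-indexed family of open sets. Slices, boxes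
  and unions all preserve directed unions, which gives joint Scott continuity in all
  coordinates.\<close>

lemma Scott_open_Union_Box_slices:
  assumes W: "Scott_open {\<U>. openin (upper_Vietoris X) \<U>} W"
  shows "Scott_open {Q. openin (sum_topology (\<lambda>_. X) I) Q}
     {Q. openin (sum_topology (\<lambda>_. X) I) Q \<and> (\<Union>i\<in>I. Box X {x. (i, x) \<in> Q}) \<in> W}"
    (is "Scott_open _ ?H")
proof -
  let ?S = "sum_topology (\<lambda>_. X) I"
  let ?G = "\<lambda>Q. \<Union>i\<in>I. Box X {x. (i, x) \<in> Q}"
  have slice: "openin X {x. (i, x) \<in> Q}" if "openin ?S Q" "i \<in> I" for Q i
    using that by (simp add: openin_sum_topology)
  have G: "openin (upper_Vietoris X) (?G Q)" if "openin ?S Q" for Q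
    using slice[OF that] by (auto intro: openin_Box)
  have G_mono: "?G Q \<subseteq> ?G Q'" if "Q \<subseteq> Q'" for Q Q'
    using that by (intro UN_mono Box_mono) auto
  show ?thesis
  proof (rule Scott_open_opensI)
    fix Q Q' assume "Q \<in> ?H" "openin ?S Q'" "Q \<subseteq> Q'"
    then show "Q' \<in> ?H" using Scott_open_upward[OF W _ _ G_mono[of Q Q']] G[of Q'] by simp
  next
    fix D assume D: "\<And>Q. Q \<in> D \<Longrightarrow> openin ?S Q" "directed_set D" and "\<Union>D \<in> ?H"
    have "Box X {x. (i, x) \<in> \<Union>D} = (\<Union>Q\<in>D. Box X {x. (i, x) \<in> Q})" if "i \<in> I" for i
    proof -
      let ?E = "(\<lambda>Q. {x. (i, x) \<in> Q}) ` D"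
      have "directed_set ?E"
        unfolding directed_set_def
      proof (intro conjI ballI)
        fix A B assume "A \<in> ?E" "B \<in> ?E"
        then obtain Q Q' where Q: "Q \<in> D" "Q' \<in> D" "A = {x. (i, x) \<in> Q}" "B = {x. (i, x) \<in> Q'}"
          by auto
        then obtain P where "P \<in> D" "Q \<subseteq> P" "Q' \<subseteq> P" using D(2) unfolding directed_set_def by blast
        then show "\<exists>C\<in>?E. A \<subseteq> C \<and> B \<subseteq> C" using Q by (intro bexI[of _ "{x. (i, x) \<in> P}"]) auto
      qed (use D(2) in \<open>auto simp: directed_set_def\<close>)
      then have "Box X (\<Union>?E) = (\<Union>U\<in>?E. Box X U)"
        using slice[OF D(1) that] by (intro Box_directed_Union) auto
      moreover have "\<Union>?E = {x. (i, x) \<in> \<Union>D}" by auto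
      ultimately show ?thesis by simp
    qed
    then have "?G (\<Union>D) = \<Union>(?G ` D)" by auto
    then have GW: "\<Union>(?G ` D) \<in> W" using \<open>\<Union>D \<in> ?H\<close> by auto
    have sub: "?G ` D \<subseteq> {\<U>. openin (upper_Vietoris X) \<U>}" using G D(1) by blast
    have dir: "directed_set (?G ` D)"
      unfolding directed_set_def
    proof (intro conjI ballI)
      fix A B assume "A \<in> ?G ` D" "B \<in> ?G ` D"
      then obtain Q Q' where Q: "Q \<in> D" "Q' \<in> D" "A = ?G Q" "B = ?G Q'" by blast
      then obtain P where "P \<in> D" "Q \<subseteq> P" "Q' \<subseteq> P" using D(2) unfolding directed_set_def by blast
      then show "\<exists>C\<in>?G ` D. A \<subseteq> C \<and> B \<subseteq> C"
        unfolding Q(3,4) by (intro bexI[of _ "?G P"] conjI G_mono imageI)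
    qed (use D(2) in \<open>auto simp: directed_set_def\<close>)
    obtain A where "A \<in> ?G ` D" "A \<in> W"
      using Scott_open_directed[OF W sub dir _ GW] by (auto simp: isLub_openin_iff[OF sub])
    then show "\<exists>Q\<in>D. Q \<in> ?H" using D(1) by auto
  qed auto
qed

text \<open>The finitely many open sets have to be shrunk to compact sets simultaneously, as the
  Scott topology of a product may be finer than the product of the Scott topologies. Consonance of
  a finite sum of copies of the space does this.\<close>

lemma continuous_map_alpha:
  fixes X :: "'a topology"
  assumes cons: "\<And>I :: 'a set set. consonant (sum_topology (\<lambda>_. X) I)"
  shows "continuous_map (lower_Vietoris (opens_space X)) (opens_space (upper_Vietoris X)) (alpha X)"
  unfolding continuous_map_def
proof (intro conjI allI impI)
  show "alpha X \<in> topspace (lower_Vietoris (opens_space X)) \<rightarrow>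
      topspace (opens_space (upper_Vietoris X))"
    using openin_alpha by auto
next
  fix W assume "openin (opens_space (upper_Vietoris X)) W"
  then have W: "Scott_open {\<U>. openin (upper_Vietoris X) \<U>} W" by (simp add: openin_opens_space)
  let ?L = "lower_Vietoris (opens_space X)"
  show "openin ?L {\<AA> \<in> topspace ?L. alpha X \<AA> \<in> W}"
  proof (subst openin_subopen, intro ballI)
    fix \<AA> assume "\<AA> \<in> {\<AA> \<in> topspace ?L. alpha X \<AA> \<in> W}"
    then have \<AA>: "closedin (opens_space X) \<AA>" and \<AA>W: "alpha X \<AA> \<in> W" by auto
    have \<AA>_open: "openin X U" if "U \<in> \<AA>" for U
      using \<AA> that by (auto simp: closedin_opens_space)
    have "\<And>C. C \<in> Box X ` \<AA> \<Longrightarrow> openin (upper_Vietoris X) C" using \<AA>_open openin_Box by auto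
    then obtain F where "finite F" "F \<subseteq> Box X ` \<AA>" "\<Union>F \<in> W"
      using Scott_open_finite_subcover[OF W \<AA>W, of "Box X ` \<AA>"] by (auto simp: alpha_def)
    \<comment> \<open>The chosen open sets serve as their own indices, which is why sums over sets
      of type \<open>'a set set\<close> occur.\<close>
    then obtain I where I: "I \<subseteq> \<AA>" "finite I" "(\<Union>U\<in>I. Box X U) \<in> W"
      using finite_subset_image by metis
    let ?S = "sum_topology (\<lambda>_. X) I"
    let ?H = "{Q. openin ?S Q \<and> (\<Union>i\<in>I. Box X {x. (i, x) \<in> Q}) \<in> W}"
    have slices: "(\<Union>i\<in>I. Box X {x. (i, x) \<in> Sigma I V}) = (\<Union>i\<in>I. Box X (V i))" for V
      by simp
    \<comment> \<open>The tautological family: its slice at \<open>U\<close> is \<open>U\<close>.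
      Consonance shrinks all slices at once to those of one compact \<open>K\<close>.\<close>
    have "openin ?S (Sigma I (\<lambda>U. U))" using I(1) \<AA>_open by (auto simp: openin_disjoint_union)
    then have "Sigma I (\<lambda>U. U) \<in> ?H" using I(3) by (simp add: slices)
    then obtain K where K: "K \<in> Box ?S (Sigma I (\<lambda>U. U))"
      "\<And>Q. \<lbrakk>openin ?S Q; K \<subseteq> Q\<rbrakk> \<Longrightarrow> Q \<in> ?H"
      using cons[of I] Scott_open_Union_Box_slices[OF W, of I] unfolding consonant_def by meson
    then have K': "compactin ?S K" "K \<subseteq> Sigma I (\<lambda>U. U)" by (auto simp: Box_def)
    define N where "N U = {V. openin X V \<and> {x. (U, x) \<in> K} \<subseteq> V}" for U
    \<comment> \<open>A finite intersection of subbasic sets, the neighbourhood of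
      \<open>\<AA>\<close> sought; the factor \<open>topspace ?L\<close> takes care of an empty
      \<open>I\<close>. That \<open>\<AA>\<close> belongs to it is witnessed by \<open>U\<close>
      itself in each \<open>N U\<close>.\<close>
    let ?T = "topspace ?L \<inter> \<Inter>(Diamond (opens_space X) ` N ` I)"
    have "openin ?L (Diamond (opens_space X) (N U))" for U
      unfolding N_def
      by (intro openin_Diamond)
        (simp add: openin_opens_space Scott_open_compact_nbhds compactin_sum_slice[OF K'(1)])
    then have "openin ?L ?T" using I(2) by (intro openin_Int_Inter openin_topspace) auto
    moreover have "\<AA> \<in> ?T"
      using \<AA> I(1) K'(2) \<AA>_open by (fastforce simp: Diamond_def N_def)
    moreover have "?T \<subseteq> {\<AA> \<in> topspace ?L. alpha X \<AA> \<in> W}"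
    proof
      fix \<BB> assume T: "\<BB> \<in> ?T"
      then have \<BB>: "closedin (opens_space X) \<BB>" by simp
      \<comment> \<open>Choosing \<open>V U\<close> from \<open>\<BB>\<close> in each
        \<open>N U\<close> assembles an open set of the sum around \<open>K\<close>, so the union of
        the boxes of the \<open>V U\<close> is in \<open>W\<close>, and it lies below
        \<open>alpha X \<BB>\<close>.\<close>
      have "\<forall>U\<in>I. \<exists>V. V \<in> \<BB> \<and> V \<in> N U" using T by (auto simp: Diamond_def)
      then obtain V where V: "\<And>U. U \<in> I \<Longrightarrow> V U \<in> \<BB> \<and> V U \<in> N U" by metis
      have "openin ?S (Sigma I V)" using V by (auto simp: openin_disjoint_union N_def)
      moreover have "K \<subseteq> Sigma I V" using V K'(2) by (auto simp: N_def)
      ultimately have "Sigma I V \<in> ?H" by (rule K(2))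
      then have "(\<Union>i\<in>I. Box X (V i)) \<in> W" by simp
      moreover have "(\<Union>i\<in>I. Box X (V i)) \<subseteq> alpha X \<BB>" using V by (auto simp: alpha_def)
      ultimately have "alpha X \<BB> \<in> W"
        using Scott_open_upward[OF W] openin_alpha[OF \<BB>] by blast
      then show "\<BB> \<in> {\<AA> \<in> topspace ?L. alpha X \<AA> \<in> W}" using \<BB> by simp
    qed
    ultimately show "\<exists>T. openin ?L T \<and> \<AA> \<in> T \<and> T \<subseteq> {\<AA> \<in> topspace ?L. alpha X \<AA> \<in> W}"
      by blast
  qed
qed

theorem theorem8p4:
  fixes X :: "'a topology"
  assumes "quasi_Polish_space X"
  shows "homeomorphic_maps (lower_Vietoris (opens_space X)) (opens_space (upper_Vietoris X))
           (alpha X) (beta X)"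
proof -
  obtain d where d: "Smyth_complete_space X d"
    using assms by (auto simp: quasi_Polish_space_def Smyth_complete_space_def)
  have "consonant X" using d by (rule Smyth_complete_space.consonant)
  moreover have "consonant (sum_topology (\<lambda>_. X) I)" for I :: "'a set set"
    using Smyth_complete_space_sum[OF d] by (rule Smyth_complete_space.consonant)
  ultimately show ?thesis
    unfolding homeomorphic_maps_def
    by (simp add: continuous_map_alpha continuous_map_beta beta_alpha alpha_beta)
qed

end
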